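(* Let $r\ge 4$ and $k\ge 2$ be integers, and let $K$ be an $m$-chromatic graph with $h_r(K)<k$. Fix a proper surjective $m$-colouring $\varphi:V(K)\to[m]$, and put $a=k-1$. For a cycle $C$ of $K$ let $$\Pi(C)=\bigl\{\{\varphi(x),\varphi(y)\}: xy\in E(C)\bigr\}\subseteq\binom{[m]}2 .$$ (a) If $\eta:V(K)\to[a]$ is any map and $P_\eta$ is the graph on $[m]$ in which $ij$ is an edge when some edge of $K$ between the colour classes $\varphi^{-1}(i)$ and $\varphi^{-1}(j)$ is $\eta$-monochromatic (its two ends have the same $\eta$-value), then $\alpha(P_\eta)\le a$. Consequently, $$e(P_\eta)\ge \frac{m^2}{2a}-\frac m2 .$$ (b) If $T$ is a graph on $[m]$ whose edge set meets $\Pi(C)$ for every cycle $C$ of $K$ of length less than $r$, then $\alpha(T)\le a$ and hence $$e(T)\ge \frac{m^2}{2a}-\frac m2 .$$ (c) The graph $K$ contains a family $\mathcal M$ of cycles of length less than $r$ such that the sets $\Pi(C)$, $C\in\mathcal M$, are pairwise disjoint and $$|\mathcal M|\ge \frac1{r-1}\left(\frac{m^2}{2a}-\frac m2\right).$$ These cycles are pairwise edge-disjoint in $K$.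
   Context: All graphs are finite and simple; subgraphs need not be induced. $\chi$ is the chromatic number, $\alpha$ the independence number, $e$ the number of edges; $[m]=\{1,\dots,m\}$. $m$-chromatic means $\chi(K)=m$. The girth of a forest is $\infty$. $h_r(K)=\max\{\chi(H):H\subseteq K,\ \operatorname{girth}(H)\ge r\}$. *)

theory Defs
  imports Complex_Main "HOL-Library.FuncSet" "HOL-Library.Extended_Nat"
begin

datatype 'a graph = Graph (verts: "'a set") (edges: "'a set set")

definition simple_graph :: "'a graph \<Rightarrow> bool" where
  "simple_graph G \<longleftrightarrow> finite (verts G) \<and> (\<forall>e \<in> edges G. e \<subseteq> verts G \<and> card e = 2)"

definition subgraph :: "'a graph \<Rightarrow> 'a graph \<Rightarrow> bool" where
  "subgraph H G \<longleftrightarrow> simple_graph H \<and> verts H \<subseteq> verts G \<and> edges H \<subseteq> edges G"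

definition proper_colouring :: "'a graph \<Rightarrow> nat set \<Rightarrow> ('a \<Rightarrow> nat) \<Rightarrow> bool" where
  "proper_colouring G S c \<longleftrightarrow>
     c \<in> verts G \<rightarrow> S \<and> (\<forall>x y. {x, y} \<in> edges G \<longrightarrow> c x \<noteq> c y)"

definition chromatic_number :: "'a graph \<Rightarrow> nat" where
  "chromatic_number G = (LEAST n. \<exists>c. proper_colouring G {1..n} c)"

definition independent :: "'a graph \<Rightarrow> 'a set \<Rightarrow> bool" where
  "independent G S \<longleftrightarrow> S \<subseteq> verts G \<and> (\<forall>x\<in>S. \<forall>y\<in>S. {x, y} \<notin> edges G)"

definition independence_number :: "'a graph \<Rightarrow> nat" where
  "independence_number G = Max {card S | S. independent G S}"

text \<open>A cycle is a graph rather than a closed walk, so that it has no distinguished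
  starting point or orientation; its length is its number of edges.\<close>

definition cycle_graph :: "'a graph \<Rightarrow> bool" where
  "cycle_graph C \<longleftrightarrow> (\<exists>p. length p \<ge> 3 \<and> distinct p \<and>
     C = Graph (set p) {{p ! i, p ! (Suc i mod length p)} | i. i < length p})"

definition cycle_of :: "'a graph \<Rightarrow> 'a graph \<Rightarrow> bool" where
  "cycle_of G C \<longleftrightarrow> cycle_graph C \<and> subgraph C G"

definition cycle_length :: "'a graph \<Rightarrow> nat" where
  "cycle_length C = card (edges C)"

text \<open>The infimum of the empty set of extended naturals is \<open>\<infinity>\<close>, so forests have infinite girth.\<close>

definition girth :: "'a graph \<Rightarrow> enat" where
  "girth G = (INF C \<in> {C. cycle_of G C}. enat (cycle_length C))"

text \<open>For a finite graph the maximum is over a finite set, nonempty because of the null subgraph.\<close>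

definition h :: "nat \<Rightarrow> 'a graph \<Rightarrow> nat" where
  "h r G = Max {chromatic_number H | H. subgraph H G \<and> girth H \<ge> enat r}"

text \<open>\<open>\<Pi>(C)\<close>, with respect to the colouring \<open>\<phi>\<close>.\<close>

definition colour_pairs :: "('a \<Rightarrow> nat) \<Rightarrow> 'a graph \<Rightarrow> nat set set" where
  "colour_pairs \<phi> C = {{\<phi> x, \<phi> y} | x y. {x, y} \<in> edges C}"

text \<open>\<open>P\<^sub>\<eta>\<close>. The condition \<open>i \<noteq> j\<close> is automatic when \<open>\<phi>\<close> is proper.\<close>

definition mono_graph :: "'a graph \<Rightarrow> ('a \<Rightarrow> nat) \<Rightarrow> nat \<Rightarrow> ('a \<Rightarrow> nat) \<Rightarrow> nat graph" where
  "mono_graph K \<phi> m \<eta> = Graph {1..m}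
     {{i, j} | i j. i \<in> {1..m} \<and> j \<in> {1..m} \<and> i \<noteq> j \<and>
        (\<exists>x y. {x, y} \<in> edges K \<and> \<phi> x = i \<and> \<phi> y = j \<and> \<eta> x = \<eta> y)}"

end

theory Submission
  imports Defs
begin

text \<open>If \<open>I\<close> is independent in \<open>P\<^sub>\<eta>\<close>, then recolouring the classes in \<open>I\<close> by \<open>\<eta>\<close> and keeping \<open>\<phi>\<close>
  elsewhere is a proper colouring of \<open>K\<close> with \<open>m - |I| + a\<close> colours, so \<open>|I| \<le> a\<close>; Turan's theorem
  then bounds the number of edges. For (b), deleting from \<open>K\<close> all edges whose colour pair lies in
  \<open>T\<close> leaves a graph of girth at least \<open>r\<close>, so it has a proper colouring \<open>\<eta>\<close> with \<open>a\<close> colours, and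
  \<open>P\<^sub>\<eta> \<subseteq> T\<close>. For (c), the union of the sets \<open>\<Pi>(C)\<close> over a maximal family of short cycles with
  disjoint \<open>\<Pi>(C)\<close> satisfies the hypothesis of (b) and has at most \<open>r - 1\<close> edges per cycle.\<close>

section \<open>Turan's theorem\<close>

text \<open>Counting ordered pairs, the diagonal included, turns Turan's bound into \<open>n\<^sup>2 \<le> a (2 e + n)\<close>.\<close>

lemma turan_relation:
  fixes R :: "'a \<Rightarrow> 'a \<Rightarrow> bool"
  assumes "finite V" and "symp R" and "reflp R"
    and "\<And>S. S \<subseteq> V \<Longrightarrow> (\<And>x y. x \<in> S \<Longrightarrow> y \<in> S \<Longrightarrow> x \<noteq> y \<Longrightarrow> \<not> R x y) \<Longrightarrow> card S \<le> a"
  shows "(card V)\<^sup>2 \<le> a * card {(x, y). x \<in> V \<and> y \<in> V \<and> R x y}"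
  using assms(1,4)
proof (induction a arbitrary: V)
  case 0
  have "card {x} \<le> 0" if "x \<in> V" for x
    using that by (intro "0.prems"(2)) auto
  then have "V = {}" by auto
  then show ?case by simp
next
  case (Suc a)
  define N where "N x = {y \<in> V. R x y}" for x
  define P where "P W = {(x, y). x \<in> W \<and> y \<in> W \<and> R x y}" for W
  have finN: "finite (N x)" for x
    using Suc.prems(1) by (simp add: N_def)
  show ?case
  proof (cases "V = {}")
    case True
    then show ?thesis by simp
  next
    case False
    \<comment> \<open>\<open>v\<close> has minimum degree, counted with itself because
      \<open>R\<close> is reflexive. The induction removes all of \<open>N v\<close>, so that
      \<open>v\<close> enlarges by one every set of pairwise unrelated elements of the rest.\<close>
    then obtain v where v: "v \<in> V" and vmin: "\<And>x. x \<in> V \<Longrightarrow> card (N v) \<le> card (N x)"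
      using arg_min_if_finite[OF Suc.prems(1), of "\<lambda>x. card (N x)"]
      by (metis not_le)
    define t where "t = card (N v)"
    define W where "W = V - N v"
    have finW: "finite W" using Suc.prems(1) by (simp add: W_def)
    have NV: "N v \<subseteq> V" by (auto simp: N_def)
    have cV: "card V = card W + t"
      unfolding W_def t_def using card_Diff_subset[OF finN NV] card_mono[OF Suc.prems(1) NV] by simp
    have vN: "v \<in> N v" using v assms(3) by (simp add: N_def reflpD)
    have IH: "(card W)\<^sup>2 \<le> a * card (P W)"
      unfolding P_def
    proof (rule Suc.IH[OF finW])
      fix S assume S: "S \<subseteq> W" and ind: "\<And>x y. x \<in> S \<Longrightarrow> y \<in> S \<Longrightarrow> x \<noteq> y \<Longrightarrow> \<not> R x y"
      have vS: "v \<notin> S" using S vN by (auto simp: W_def)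
      have nv: "\<not> R v s" "\<not> R s v" if "s \<in> S" for s
        using that S assms(2) by (auto simp: W_def N_def dest: sympD)
      have "card (insert v S) \<le> Suc a"
      proof (rule Suc.prems(2))
        show "insert v S \<subseteq> V" using v S by (auto simp: W_def)
        show "\<not> R x y" if "x \<in> insert v S" "y \<in> insert v S" "x \<noteq> y" for x y
          using that ind nv by auto
      qed
      moreover have "finite S" using S finW finite_subset by blast
      ultimately show "card S \<le> a" using vS by simp
    qed
    \<comment> \<open>Each of the \<open>t\<close> elements of \<open>N v\<close> is the first entry
      of at least \<open>t\<close> pairs, by the choice of \<open>v\<close>; no pair in
      \<open>P W\<close> starts in \<open>N v\<close>.\<close>
    have "card (P W) + t * t \<le> card (P V)"
    proof -
      have Sig: "card (SIGMA x:N v. N x) = (\<Sum>x\<in>N v. card (N x))"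
        using finN by (simp add: card_SigmaI)
      have "(\<Sum>x\<in>N v. t) \<le> (\<Sum>x\<in>N v. card (N x))"
        using vmin NV by (intro sum_mono) (auto simp: t_def)
      then have "t * t \<le> card (SIGMA x:N v. N x)"
        using Sig by (simp add: t_def)
      moreover have "card (P W \<union> (SIGMA x:N v. N x)) = card (P W) + card (SIGMA x:N v. N x)"
      proof (rule card_Un_disjoint)
        show "finite (P W)"
          using finite_subset[of "P W" "W \<times> W"] finW by (auto simp: P_def)
        show "P W \<inter> (SIGMA x:N v. N x) = {}" by (auto simp: P_def W_def)
      qed (simp add: finN)
      moreover have "card (P W \<union> (SIGMA x:N v. N x)) \<le> card (P V)"
      proof (rule card_mono)
        show "finite (P V)"
          using finite_subset[of "P V" "V \<times> V"] Suc.prems(1) by (auto simp: P_def)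
        show "P W \<union> (SIGMA x:N v. N x) \<subseteq> P V" by (auto simp: P_def W_def N_def)
      qed
      ultimately show ?thesis by linarith
    qed
    moreover have "(card W + t)\<^sup>2 \<le> Suc a * (card (P W) + t * t)"
    \<comment> \<open>For \<open>a = 0\<close> the induction hypothesis leaves \<open>W\<close>
      empty. Otherwise the inequality is proved after multiplication by \<open>a\<close>, which is
      then cancelled.\<close>
    proof (cases "a = 0")
      case True
      then show ?thesis using IH by (simp add: power2_eq_square)
    next
      case False
      define w p b where "w = int (card W)" and "p = int (card (P W))" and "b = int a"
      have b: "b > 0" using False by (simp add: b_def)
      have IH': "w\<^sup>2 \<le> b * p"
        using IH unfolding w_def p_def b_def by (metis of_nat_le_iff of_nat_mult of_nat_power)
      \<comment> \<open>Cauchy-Schwarz: the difference of the two sides times \<open>b\<close> is at least \<open>(w - b t)\<^sup>2\<close>.\<close>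
      have "b * (w + int t)\<^sup>2 + (w - b * int t)\<^sup>2 = (b + 1) * w\<^sup>2 + b * (b + 1) * (int t)\<^sup>2"
        by (simp add: power2_eq_square algebra_simps)
      also have "\<dots> \<le> (b + 1) * (b * p) + b * (b + 1) * (int t)\<^sup>2"
        using IH' b by (intro add_right_mono mult_left_mono) auto
      also have "\<dots> = b * ((b + 1) * (p + int t * int t))"
        by (simp add: power2_eq_square algebra_simps)
      finally have "b * (w + int t)\<^sup>2 \<le> b * ((b + 1) * (p + int t * int t))"
        using zero_le_power2[of "w - b * int t"] by linarith
      then have "(w + int t)\<^sup>2 \<le> (b + 1) * (p + int t * int t)"
        using b by simp
      then have "int ((card W + t)\<^sup>2) \<le> int (Suc a * (card (P W) + t * t))"
        by (simp add: w_def p_def b_def algebra_simps)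
      then show ?thesis by (simp only: of_nat_le_iff)
    qed
    ultimately have "(card V)\<^sup>2 \<le> Suc a * card (P V)"
      unfolding cV by (meson le_trans mult_le_mono2)
    then show ?thesis by (simp only: P_def)
  qed
qed

section \<open>Edges and independent sets of finite graphs\<close>

lemma finite_edges: "simple_graph G \<Longrightarrow> finite (edges G)"
  using finite_subset[of "edges G" "Pow (verts G)"] by (auto simp: simple_graph_def)

lemma edge_verts:
  assumes "simple_graph G" and "{x, y} \<in> edges G"
  shows "x \<in> verts G" and "y \<in> verts G" and "x \<noteq> y"
  using assms by (auto simp: simple_graph_def)

lemma finite_independent_cards:
  assumes "finite (verts G)"
  shows "finite {card S | S. independent G S}"
  using finite_subset[of "{card S | S. independent G S}" "card ` Pow (verts G)"] assms
  by (auto simp: independent_def)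

lemma card_le_independence_number:
  assumes "finite (verts G)" and "independent G S"
  shows "card S \<le> independence_number G"
  unfolding independence_number_def
  using assms finite_independent_cards by (intro Max_ge) auto

lemma independence_number_le:
  assumes "finite (verts G)" and "\<And>S. independent G S \<Longrightarrow> card S \<le> a"
  shows "independence_number G \<le> a"
proof -
  have "independent G {}" by (simp add: independent_def)
  then show ?thesis
    unfolding independence_number_def
    using assms finite_independent_cards by (subst Max_le_iff) auto
qed

text \<open>The relation "equal or adjacent" has at most \<open>n + 2 e\<close> ordered pairs: the
  diagonal and two orientations of each edge. Its sets of pairwise unrelated elements are the
  independent sets, so the bound for relations applies and is solved for \<open>e\<close>.\<close>

theorem turan:
  assumes G: "simple_graph G" and "independence_number G \<le> a" and "a \<ge> 1"
  shows "real (card (edges G)) \<ge> (real (card (verts G)))\<^sup>2 / (2 * real a) - real (card (verts G)) / 2"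
proof -
  define V where "V = verts G"
  define R where "R x y \<longleftrightarrow> x = y \<or> {x, y} \<in> edges G" for x y
  define Q where "Q = {(x, y). x \<in> V \<and> y \<in> V \<and> R x y}"
  have fin: "finite V" using G by (simp add: simple_graph_def V_def)
  have "(card V)\<^sup>2 \<le> a * card Q"
    unfolding Q_def
  proof (rule turan_relation[OF fin])
    show "symp R" by (auto simp: symp_def R_def insert_commute)
    show "reflp R" by (auto simp: reflp_def R_def)
    fix S assume "S \<subseteq> V" and "\<And>x y. x \<in> S \<Longrightarrow> y \<in> S \<Longrightarrow> x \<noteq> y \<Longrightarrow> \<not> R x y"
    then have "independent G S"
      unfolding independent_def R_def V_def using edge_verts(3)[OF G] by blast
    then show "card S \<le> a"
      using card_le_independence_number[of G S] fin assms(2) by (simp add: V_def)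
  qed
  moreover have "card Q \<le> card V + 2 * card (edges G)"
  proof -
    define F where "F e = {(x, y). {x, y} = e}" for e :: "'a set"
    have F: "finite (F e) \<and> card (F e) \<le> 2" if e: "e \<in> edges G" for e
    proof -
      obtain u v where "e = {u, v}"
        using e G by (metis card_2_iff simple_graph_def)
      then have "F e \<subseteq> {(u, v), (v, u)}" by (auto simp: F_def doubleton_eq_iff)
      \<comment> \<open>Passing through a list of length two avoids any appeal to
        \<open>u \<noteq> v\<close>.\<close>
      moreover have "card {(u, v), (v, u)} \<le> 2"
        using card_length[of "[(u, v), (v, u)]"] by simp
      ultimately show ?thesis
        using card_mono[of "{(u, v), (v, u)}" "F e"] finite_subset[of "F e" "{(u, v), (v, u)}"]
        by simp
    qed
    have "Q \<subseteq> (\<lambda>x. (x, x)) ` V \<union> (\<Union>e\<in>edges G. F e)"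
      by (auto simp: Q_def R_def F_def)
    then have "card Q \<le> card ((\<lambda>x. (x, x)) ` V \<union> (\<Union>e\<in>edges G. F e))"
      using F fin finite_edges[OF G] by (intro card_mono) auto
    also have "\<dots> \<le> card ((\<lambda>x. (x, x)) ` V) + card (\<Union>e\<in>edges G. F e)"
      by (rule card_Un_le)
    also have "card ((\<lambda>x. (x, x)) ` V) \<le> card V" by (rule card_image_le[OF fin])
    also have "card (\<Union>e\<in>edges G. F e) \<le> (\<Sum>e\<in>edges G. card (F e))"
      by (rule card_UN_le[OF finite_edges[OF G]])
    also have "\<dots> \<le> (\<Sum>e\<in>edges G. 2)" using F by (intro sum_mono) auto
    finally show ?thesis by (simp add: mult.commute)
  qed
  ultimately have "(card V)\<^sup>2 \<le> a * (card V + 2 * card (edges G))"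
    by (meson le_trans mult_le_mono2)
  then have "(real (card V))\<^sup>2 \<le> real a * (real (card V) + 2 * real (card (edges G)))"
    using of_nat_mono[of "(card V)\<^sup>2" "a * (card V + 2 * card (edges G))", where 'a = real] by simp
  then show ?thesis
    using assms(3) by (simp add: V_def field_simps)
qed

section \<open>Colourings and girth\<close>

text \<open>An arbitrary finite palette is allowed because recolouring some classes leaves gaps
  among the colours; a bijection onto an initial segment closes them.\<close>

lemma chromatic_number_le:
  assumes "finite S" and "proper_colouring G S c" and "simple_graph G"
  shows "chromatic_number G \<le> card S"
proof -
  obtain f where f: "bij_betw f S {1..card S}"
    using finite_same_card_bij[OF assms(1), of "{1..card S}"] by auto
  have "proper_colouring G {1..card S} (f \<circ> c)"
    unfolding proper_colouring_def
  proof (intro conjI allI impI)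
    show "f \<circ> c \<in> verts G \<rightarrow> {1..card S}"
      using assms(2) bij_betwE[OF f] by (auto simp: proper_colouring_def)
    fix x y assume e: "{x, y} \<in> edges G"
    then have "c x \<in> S" "c y \<in> S" "c x \<noteq> c y"
      using assms(2) edge_verts[OF assms(3) e] by (auto simp: proper_colouring_def)
    then show "(f \<circ> c) x \<noteq> (f \<circ> c) y"
      using f by (auto simp: bij_betw_def inj_on_def)
  qed
  then show ?thesis
    unfolding chromatic_number_def by (intro Least_le) blast
qed

text \<open>The minimum defining \<open>chromatic_number\<close> is attained as soon as some
  colouring with an initial segment as palette exists.\<close>

lemma proper_colouring_chromatic_number:
  assumes "proper_colouring G {1..n} c"
  shows "\<exists>d. proper_colouring G {1..chromatic_number G} d"
  unfolding chromatic_number_def by (rule LeastI_ex) (use assms in blast)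

text \<open>This makes the maximum in \<open>h\<close> range over a finite set, and it also bounds
  the family of short cycles.\<close>

lemma finite_subgraphs:
  assumes K: "simple_graph K"
  shows "finite {H. subgraph H K}"
proof -
  have "{H. subgraph H K} \<subseteq> (\<lambda>(V, E). Graph V E) ` (Pow (verts K) \<times> Pow (edges K))"
  proof
    fix H assume "H \<in> {H. subgraph H K}"
    then show "H \<in> (\<lambda>(V, E). Graph V E) ` (Pow (verts K) \<times> Pow (edges K))"
      by (intro image_eqI[of _ _ "(verts H, edges H)"]) (auto simp: subgraph_def)
  qed
  moreover have "finite (Pow (verts K) \<times> Pow (edges K))"
    using K finite_edges by (auto simp: simple_graph_def)
  ultimately show ?thesis
    using finite_surj by blast
qed

lemma chromatic_number_le_h:
  assumes K: "simple_graph K" and "subgraph H K" and "girth H \<ge> enat r"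
  shows "chromatic_number H \<le> h r K"
proof -
  have "finite {H. subgraph H K}" by (rule finite_subgraphs[OF K])
  then have "finite {chromatic_number H | H. subgraph H K \<and> girth H \<ge> enat r}"
    by (rule finite_surj[where f = chromatic_number]) auto
  then show ?thesis
    unfolding h_def using assms by (intro Max_ge) auto
qed

lemma subgraph_trans: "subgraph C H \<Longrightarrow> subgraph H K \<Longrightarrow> subgraph C K"
  by (auto simp: subgraph_def)

text \<open>If \<open>a\<close> were smaller than \<open>card I\<close>, replacing the colours in
  \<open>I\<close> by \<open>a\<close> new ones would colour \<open>K\<close> properly with fewer
  than \<open>m\<close> colours.\<close>

lemma card_recoloured_classes_le:
  assumes K: "simple_graph K" and "chromatic_number K = m"
    and \<phi>: "proper_colouring K {1..m} \<phi>" and \<eta>: "\<eta> \<in> verts K \<rightarrow> {1..a}"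
    and I: "I \<subseteq> {1..m}"
    and bi: "\<And>x y. {x, y} \<in> edges K \<Longrightarrow> \<phi> x \<in> I \<Longrightarrow> \<phi> y \<in> I \<Longrightarrow> \<eta> x \<noteq> \<eta> y"
  shows "card I \<le> a"
proof -
  \<comment> \<open>The shift by \<open>m\<close> separates the new colours from the old ones, so
    only edges with both ends recoloured or both ends unchanged need an argument.\<close>
  define c where "c x = (if \<phi> x \<in> I then m + \<eta> x else \<phi> x)" for x
  define S where "S = ({1..m} - I) \<union> {m+1..m+a}"
  have \<phi>V: "\<phi> x \<in> {1..m}" if "x \<in> verts K" for x
    using \<phi> that by (auto simp: proper_colouring_def)
  have \<eta>V: "\<eta> x \<in> {1..a}" if "x \<in> verts K" for x
    using \<eta> that by auto
  have "proper_colouring K S c"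
    unfolding proper_colouring_def
  proof (intro conjI allI impI)
    show "c \<in> verts K \<rightarrow> S"
      using \<phi>V \<eta>V by (fastforce simp: c_def S_def)
    fix x y assume e: "{x, y} \<in> edges K"
    have "\<phi> x \<noteq> \<phi> y" using \<phi> e by (auto simp: proper_colouring_def)
    then show "c x \<noteq> c y"
      using bi[OF e] \<phi>V[OF edge_verts(1)[OF K e]] \<phi>V[OF edge_verts(2)[OF K e]]
        \<eta>V[OF edge_verts(1)[OF K e]] \<eta>V[OF edge_verts(2)[OF K e]]
      by (auto simp: c_def)
  qed
  then have "m \<le> card S"
    using chromatic_number_le[of S K c] K assms(2) by (simp add: S_def)
  also have "card S = card ({1..m} - I) + card {m+1..m+a}"
    unfolding S_def by (rule card_Un_disjoint) auto
  also have "\<dots> = m - card I + a"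
    using I by (simp add: card_Diff_subset finite_subset)
  \<comment> \<open>Since \<open>card I \<le> m\<close>, the subtraction in
    \<open>m - card I + a\<close> is not truncated.\<close>
  finally show ?thesis
    using card_mono[OF _ I] by simp
qed

text \<open>In image form, the bound by the number of edges is immediate, and a common edge visibly
  yields a common colour pair.\<close>

lemma colour_pairs_eq_image:
  assumes "simple_graph C"
  shows "colour_pairs \<phi> C = (`) \<phi> ` edges C"
proof
  show "colour_pairs \<phi> C \<subseteq> (`) \<phi> ` edges C"
  proof
    fix q assume "q \<in> colour_pairs \<phi> C"
    then obtain x y where "{x, y} \<in> edges C" and q: "q = {\<phi> x, \<phi> y}"
      by (auto simp: colour_pairs_def)
    then show "q \<in> (`) \<phi> ` edges C"
      by (intro image_eqI[of _ _ "{x, y}"]) auto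
  qed
  show "(`) \<phi> ` edges C \<subseteq> colour_pairs \<phi> C"
  proof
    fix q assume "q \<in> (`) \<phi> ` edges C"
    then obtain e where e: "e \<in> edges C" "q = \<phi> ` e" by blast
    then obtain x y where "e = {x, y}"
      using assms by (metis card_2_iff simple_graph_def)
    then show "q \<in> colour_pairs \<phi> C"
      using e by (auto simp: colour_pairs_def)
  qed
qed

section \<open>The graph \<open>P\<^sub>\<eta>\<close> and transversals of the short cycles\<close>

lemma verts_mono_graph: "verts (mono_graph K \<phi> m \<eta>) = {1..m}"
  by (simp add: mono_graph_def)

lemma simple_mono_graph: "simple_graph (mono_graph K \<phi> m \<eta>)"
  by (auto simp: simple_graph_def mono_graph_def)

text \<open>On the union of the classes in an independent set of \<open>P\<^sub>\<eta>\<close>, no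
  edge of \<open>K\<close> is monochromatic under \<eta>, so the recolouring bound applies.\<close>

lemma mono_graph_independence_number_le:
  assumes K: "simple_graph K" and "chromatic_number K = m"
    and \<phi>: "proper_colouring K {1..m} \<phi>" and \<eta>: "\<eta> \<in> verts K \<rightarrow> {1..a}"
  shows "independence_number (mono_graph K \<phi> m \<eta>) \<le> a"
proof (rule independence_number_le)
  show "finite (verts (mono_graph K \<phi> m \<eta>))" by (simp add: mono_graph_def)
  fix I assume I: "independent (mono_graph K \<phi> m \<eta>) I"
  then have Im: "I \<subseteq> {1..m}" by (simp add: independent_def mono_graph_def)
  show "card I \<le> a"
  proof (rule card_recoloured_classes_le[OF K assms(2) \<phi> \<eta> Im])
    fix x y assume e: "{x, y} \<in> edges K" and xy: "\<phi> x \<in> I" "\<phi> y \<in> I"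
    show "\<eta> x \<noteq> \<eta> y"
    proof
      assume "\<eta> x = \<eta> y"
      then have "\<exists>x' y'. {x', y'} \<in> edges K \<and> \<phi> x' = \<phi> x \<and> \<phi> y' = \<phi> y \<and> \<eta> x' = \<eta> y'"
        using e by blast
      moreover have "\<phi> x \<noteq> \<phi> y" using \<phi> e by (auto simp: proper_colouring_def)
      moreover have "\<phi> x \<in> {1..m}" "\<phi> y \<in> {1..m}" using xy Im by auto
      ultimately have "{\<phi> x, \<phi> y} \<in> edges (mono_graph K \<phi> m \<eta>)"
        unfolding mono_graph_def graph.sel by blast
      then show False using I xy by (auto simp: independent_def)
    qed
  qed
qed

text \<open>A colouring \<eta> of the graph \<open>H\<close> of edges with colour pair outside
  \<open>T\<close> suffices: an \<eta>-monochromatic edge of \<open>K\<close> is not in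
  \<open>H\<close>, so its colour pair lies in \<open>T\<close>.\<close>

lemma transversal_contains_mono_graph:
  assumes K: "simple_graph K" and "h r K \<le> a" and \<phi>: "proper_colouring K {1..m} \<phi>"
    and T: "\<And>C. cycle_of K C \<Longrightarrow> cycle_length C < r \<Longrightarrow> T \<inter> colour_pairs \<phi> C \<noteq> {}"
  shows "\<exists>\<eta> \<in> verts K \<rightarrow> {1..a}. edges (mono_graph K \<phi> m \<eta>) \<subseteq> T"
proof -
  define H where "H = Graph (verts K) {e \<in> edges K. \<phi> ` e \<notin> T}"
  have HK: "subgraph H K"
    using K by (auto simp: H_def subgraph_def simple_graph_def)
  have "enat r \<le> girth H"
    unfolding girth_def
  proof (rule INF_greatest)
    fix C assume "C \<in> {C. cycle_of H C}"
    then have C: "cycle_of H C" by simp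
    then have CK: "cycle_of K C" using HK subgraph_trans by (auto simp: cycle_of_def)
    have "colour_pairs \<phi> C \<inter> T = {}"
      using C colour_pairs_eq_image[of C \<phi>] by (auto simp: cycle_of_def subgraph_def H_def)
    then have "\<not> cycle_length C < r" using T[OF CK] by blast
    then show "enat r \<le> enat (cycle_length C)" by simp
  qed
  then have le: "chromatic_number H \<le> a"
    using chromatic_number_le_h[OF K HK, of r] assms(2) by linarith
  \<comment> \<open>\<phi> serves only as a witness that \<open>H\<close> has some colouring, so
    that one with \<open>chromatic_number H\<close> colours exists.\<close>
  have "proper_colouring H {1..m} \<phi>"
    using \<phi> by (auto simp: proper_colouring_def H_def)
  then obtain \<eta> where \<eta>: "proper_colouring H {1..chromatic_number H} \<eta>"
    using proper_colouring_chromatic_number by blast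
  have "\<eta> \<in> verts K \<rightarrow> {1..a}"
    using \<eta> le order_trans by (fastforce simp: proper_colouring_def H_def Pi_def)
  moreover have "edges (mono_graph K \<phi> m \<eta>) \<subseteq> T"
    using \<eta> by (auto simp: mono_graph_def proper_colouring_def H_def)
  ultimately show ?thesis by blast
qed

text \<open>Some \<open>P\<^sub>\<eta>\<close> is a spanning subgraph of \<open>T\<close>, and
  adding edges cannot create independent sets.\<close>

lemma transversal_independence_number_le:
  assumes K: "simple_graph K" and m: "chromatic_number K = m" and "h r K \<le> a"
    and \<phi>: "proper_colouring K {1..m} \<phi>"
    and VT: "verts T = {1..m}"
    and T: "\<And>C. cycle_of K C \<Longrightarrow> cycle_length C < r \<Longrightarrow> edges T \<inter> colour_pairs \<phi> C \<noteq> {}"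
  shows "independence_number T \<le> a"
proof (rule independence_number_le)
  show "finite (verts T)" by (simp add: VT)
  obtain \<eta> where \<eta>: "\<eta> \<in> verts K \<rightarrow> {1..a}"
    and sub: "edges (mono_graph K \<phi> m \<eta>) \<subseteq> edges T"
    using transversal_contains_mono_graph[OF K assms(3) \<phi> T] by blast
  fix I assume "independent T I"
  then have "independent (mono_graph K \<phi> m \<eta>) I"
    unfolding independent_def verts_mono_graph VT using sub by blast
  then have "card I \<le> independence_number (mono_graph K \<phi> m \<eta>)"
    using simple_mono_graph by (intro card_le_independence_number) (auto simp: mono_graph_def)
  also have "\<dots> \<le> a" by (rule mono_graph_independence_number_le[OF K m \<phi> \<eta>])
  finally show "card I \<le> a" .
qed

section \<open>Packing short cycles\<close>

lemma cycle_edges_nonempty: "cycle_graph C \<Longrightarrow> edges C \<noteq> {}"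
  by (fastforce simp: cycle_graph_def)

text \<open>An inclusion-maximal disjoint subfamily works: a member of \<C> whose set missed the
  whole union could be added.\<close>

lemma maximal_disjoint_subfamily:
  assumes "finite \<C>" and "\<And>C. C \<in> \<C> \<Longrightarrow> f C \<noteq> {}"
  obtains \<M> where "\<M> \<subseteq> \<C>" and "pairwise (\<lambda>C D. f C \<inter> f D = {}) \<M>"
    and "\<And>C. C \<in> \<C> \<Longrightarrow> \<Union>(f ` \<M>) \<inter> f C \<noteq> {}"
proof -
  define F where "F = {\<M>. \<M> \<subseteq> \<C> \<and> pairwise (\<lambda>C D. f C \<inter> f D = {}) \<M>}"
  have "finite F" using finite_subset[of F "Pow \<C>"] assms(1) by (auto simp: F_def)
  moreover have "{} \<in> F" by (simp add: F_def)
  ultimately obtain \<M> where M: "\<M> \<in> F" and max: "\<And>N. N \<in> F \<Longrightarrow> \<M> \<subseteq> N \<Longrightarrow> \<M> = N"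
    using finite_has_maximal[of F] by auto
  have "\<Union>(f ` \<M>) \<inter> f C \<noteq> {}" if C: "C \<in> \<C>" for C
  proof
    assume disj: "\<Union>(f ` \<M>) \<inter> f C = {}"
    then have "insert C \<M> \<in> F"
      using M C by (auto simp: F_def pairwise_insert)
    \<comment> \<open>Maximality puts \<open>C\<close> into \<M> already, so \<open>f C\<close> lies
      inside a union that it misses, which contradicts \<open>f C \<noteq> {}\<close>.\<close>
    then have "C \<in> \<M>" using max[of "insert C \<M>"] by auto
    then show False using disj assms(2)[OF C] by auto
  qed
  then show ?thesis using M that by (auto simp: F_def)
qed

theorem theorem1p8:
  fixes K :: "'a graph" and r k m a :: nat and \<phi> :: "'a \<Rightarrow> nat"
  assumes "r \<ge> 4" and "k \<ge> 2"
    and "simple_graph K" and "chromatic_number K = m"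
    and "h r K < k"
    and "proper_colouring K {1..m} \<phi>" and "\<phi> ` verts K = {1..m}"
    and "a = k - 1"
  shows
    "(\<forall>\<eta> :: 'a \<Rightarrow> nat. \<eta> \<in> verts K \<rightarrow> {1..a} \<longrightarrow>
        independence_number (mono_graph K \<phi> m \<eta>) \<le> a \<and>
        real (card (edges (mono_graph K \<phi> m \<eta>))) \<ge> (real m)\<^sup>2 / (2 * real a) - real m / 2)
     \<and>
     (\<forall>T :: nat graph. simple_graph T \<and> verts T = {1..m} \<and>
        (\<forall>C. cycle_of K C \<and> cycle_length C < r \<longrightarrow> edges T \<inter> colour_pairs \<phi> C \<noteq> {}) \<longrightarrow>
        independence_number T \<le> a \<and>
        real (card (edges T)) \<ge> (real m)\<^sup>2 / (2 * real a) - real m / 2)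
     \<and>
     (\<exists>\<M> :: 'a graph set. finite \<M> \<and>
        (\<forall>C\<in>\<M>. cycle_of K C \<and> cycle_length C < r) \<and>
        pairwise (\<lambda>C D. colour_pairs \<phi> C \<inter> colour_pairs \<phi> D = {}) \<M> \<and>
        real (card \<M>) \<ge> 1 / (real r - 1) * ((real m)\<^sup>2 / (2 * real a) - real m / 2) \<and>
        pairwise (\<lambda>C D. edges C \<inter> edges D = {}) \<M>)"
proof -
  note K = assms(3) and m = assms(4) and \<phi> = assms(6)
  have a: "a \<ge> 1" and ha: "h r K \<le> a" using assms by auto
  let ?b = "(real m)\<^sup>2 / (2 * real a) - real m / 2"
  have A: "independence_number (mono_graph K \<phi> m \<eta>) \<le> a \<and> real (card (edges (mono_graph K \<phi> m \<eta>))) \<ge> ?b"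
    if "\<eta> \<in> verts K \<rightarrow> {1..a}" for \<eta>
    using turan[OF simple_mono_graph mono_graph_independence_number_le[OF K m \<phi> that] a]
      mono_graph_independence_number_le[OF K m \<phi> that]
    by (simp add: mono_graph_def)
  have B: "independence_number T \<le> a \<and> real (card (edges T)) \<ge> ?b"
    if T: "simple_graph T" "verts T = {1..m}"
      "\<forall>C. cycle_of K C \<and> cycle_length C < r \<longrightarrow> edges T \<inter> colour_pairs \<phi> C \<noteq> {}" for T
  proof -
    have "independence_number T \<le> a"
      using T(3) by (intro transversal_independence_number_le[OF K m ha \<phi> T(2)]) auto
    then show ?thesis using turan[OF T(1) _ a] T(2) by simp
  qed
  define \<C> where "\<C> = {C. cycle_of K C \<and> cycle_length C < r}"
  have simple: "simple_graph C" and sub: "edges C \<subseteq> edges K" if "C \<in> \<C>" for C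
    using that by (auto simp: \<C>_def cycle_of_def subgraph_def)
  have fin: "finite \<C>"
    using finite_subset[OF _ finite_subgraphs[OF K], of \<C>] by (auto simp: \<C>_def cycle_of_def)
  have ne: "colour_pairs \<phi> C \<noteq> {}" if "C \<in> \<C>" for C
    using that cycle_edges_nonempty[of C] colour_pairs_eq_image[OF simple[OF that]]
    by (auto simp: \<C>_def cycle_of_def)
  obtain \<M> where M: "\<M> \<subseteq> \<C>" and disj: "pairwise (\<lambda>C D. colour_pairs \<phi> C \<inter> colour_pairs \<phi> D = {}) \<M>"
    and hit: "\<And>C. C \<in> \<C> \<Longrightarrow> \<Union>(colour_pairs \<phi> ` \<M>) \<inter> colour_pairs \<phi> C \<noteq> {}"
    by (rule maximal_disjoint_subfamily[of \<C> "colour_pairs \<phi>"]) (use fin ne in auto)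
  have finM: "finite \<M>" using M fin finite_subset by blast
  \<comment> \<open>The colour pairs used by the packing form a transversal: \<open>hit\<close> is
    precisely the hypothesis of (b) for this graph.\<close>
  define T where "T = Graph {1..m} (\<Union>(colour_pairs \<phi> ` \<M>))"
  have "simple_graph T"
  proof -
    \<comment> \<open>Colour pairs have two distinct entries because \<phi> is proper on the edges
      of \<open>K\<close>.\<close>
    have "e \<subseteq> {1..m} \<and> card e = 2" if C: "C \<in> \<M>" and e: "e \<in> colour_pairs \<phi> C" for C e
    proof -
      obtain x y where xy: "{x, y} \<in> edges K" and "e = {\<phi> x, \<phi> y}"
        using e sub[of C] C M by (auto simp: colour_pairs_def)
      then show ?thesis
        using \<phi> edge_verts[OF K xy] by (auto simp: proper_colouring_def)
    qed
    then show ?thesis by (auto simp: simple_graph_def T_def)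
  qed
  then have "?b \<le> real (card (edges T))"
    using B[of T] hit by (auto simp: T_def \<C>_def)
  also have "card (edges T) \<le> (r - 1) * card \<M>"
  proof -
    \<comment> \<open>Different edges of a cycle may share a colour pair, so its length, at most
      \<open>r - 1\<close>, is only an upper bound.\<close>
    have "card (colour_pairs \<phi> C) \<le> r - 1" if "C \<in> \<M>" for C
    proof -
      have C: "C \<in> \<C>" using that M by auto
      then have "card (colour_pairs \<phi> C) \<le> card (edges C)"
        using colour_pairs_eq_image[OF simple] finite_edges[OF simple] by (simp add: card_image_le)
      moreover have "card (edges C) < r" using C by (simp add: \<C>_def cycle_length_def)
      ultimately show ?thesis by linarith
    qed
    then have "(\<Sum>C\<in>\<M>. card (colour_pairs \<phi> C)) \<le> (r - 1) * card \<M>"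
      using sum_bounded_above[of \<M> "\<lambda>C. card (colour_pairs \<phi> C)" "r - 1"]
      by (simp add: mult.commute)
    then show ?thesis
      using card_UN_le[OF finM, of "colour_pairs \<phi>"] by (simp add: T_def)
  qed
  finally have "?b \<le> (real r - 1) * real (card \<M>)"
    using assms(1) by (simp add: of_nat_diff)
  then have bound: "real (card \<M>) \<ge> 1 / (real r - 1) * ?b"
    using assms(1) by (simp add: pos_divide_le_eq mult.commute)
  \<comment> \<open>An edge common to both cycles would have its colour pair in both sets.\<close>
  have "edges C \<inter> edges D = {}" if "colour_pairs \<phi> C \<inter> colour_pairs \<phi> D = {}" "C \<in> \<C>" "D \<in> \<C>" for C D
    using that(1) unfolding colour_pairs_eq_image[OF simple[OF that(2)]]
      colour_pairs_eq_image[OF simple[OF that(3)]] by blast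
  then have "pairwise (\<lambda>C D. edges C \<inter> edges D = {}) \<M>"
    using disj M unfolding pairwise_def by blast
  moreover have "\<forall>C\<in>\<M>. cycle_of K C \<and> cycle_length C < r"
    using M by (auto simp: \<C>_def)
  ultimately show ?thesis
    using A B finM disj bound by (intro conjI exI[of _ \<M>]) blast+
qed

end
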